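(* Let $\Gamma$ be a countable set, let $M$ be a measurable space, and let $\underline{X}=(X_k)_{k\in\Gamma}$ be a family of independent random variables with values in $M$, where $X_k$ is distributed according to a probability measure $p_k$ on $M$. Let $E\subseteq M^\Gamma$ be an event, and suppose that for every finite set $J\subseteq\Gamma$ and every $\delta>0$, the event $E$ has an injective positional symmetry $\pi\colon\Gamma\to\Gamma$ such that $\pi(J)\cap J=\varnothing$ and $\sum_{k\in\Gamma}\lVert p_{\pi(k)}-p_k\rVert_{\mathrm{TV}}<\delta$. Then $\mathbb{P}(\underline{X}\in E)\in\{0,1\}$.
   Context: $M^\Gamma$ carries the product $\sigma$-algebra, and an event $E\subseteq M^\Gamma$ is a measurable subset. A positional symmetry of an event $E\subseteq M^\Gamma$ is a map $\pi\colon\Gamma\to\Gamma$ (not required a priori to be injective or surjective) such that for every $\underline{a}=(a_k)_{k\in\Gamma}\in M^\Gamma$, one has $\underline{a}\in E$ if and only if $\underline{a}^\pi:=(a_{\pi(k)})_{k\in\Gamma}\in E$. For two probability measures $\mu,\nu$ on the same measurable space, the total variation distance is $\lVert\mu-\nu\rVert_{\mathrm{TV}}:=\sup_A|\mu(A)-\nu(A)|$, the supremum being over all measurable sets $A$. *)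

theory Defs
  imports "HOL-Probability.Probability"
begin

(* Intended for finite measures with sets \<mu> = sets \<nu>; the real-valued supremum is then
   taken over a bounded nonempty set. *)
definition tv_dist :: "'a measure \<Rightarrow> 'a measure \<Rightarrow> real" where
  "tv_dist \<mu> \<nu> = (SUP A\<in>sets \<mu>. \<bar>measure \<mu> A - measure \<nu> A\<bar>)"

(* The product M^\<Gamma> is PiM \<Gamma> (\<lambda>_. M), whose points are the functions that are undefined
   outside \<Gamma>; hence the restriction to \<Gamma> of the reindexed family. Only the values of \<pi>
   on \<Gamma> matter. *)
definition positional_symmetry ::
    "'i set \<Rightarrow> 'a measure \<Rightarrow> ('i \<Rightarrow> 'a) set \<Rightarrow> ('i \<Rightarrow> 'i) \<Rightarrow> bool" where
  "positional_symmetry \<Gamma> M E \<pi> \<longleftrightarrow>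
     \<pi> \<in> \<Gamma> \<rightarrow> \<Gamma> \<and>
     (\<forall>a\<in>space (PiM \<Gamma> (\<lambda>_. M)). a \<in> E \<longleftrightarrow> (\<lambda>k\<in>\<Gamma>. a (\<pi> k)) \<in> E)"

end

(* Approximate E by an event A depending only on a finite set J of coordinates, and let T be the
   reindexing by a symmetry that moves J off itself and almost preserves the marginals. The image
   of the product measure under T is again a product measure, with marginals p (\<pi> k), and the total
   variation distance of product measures is at most the sum of the distances of the marginals. So
   T^-1 A still approximates T^-1 E = E; it depends only on the coordinates in \<pi> ` J and hence is
   independent of A. Therefore the probability e of E satisfies e = e * e. *)
theory Submission
  imports Defs
begin

section \<open>Approximation of events by cylinders\<close>

text \<open>The sets that can be approximated contain \<open>G\<close> and are closed under
  complements and countable unions, so they fill the generated sigma-algebra. A single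
  \<open>A\<close> serves both measures, because comparing two product measures later requires one
  cylinder that is close to the event under each of them.\<close>

lemma measure_approx_by_algebra:
  assumes "finite_measure M" "finite_measure N" "sets N = sets M"
    and G: "algebra \<Omega> G" "sets M = sigma_sets \<Omega> G"
    and S: "S \<in> sets M" and "\<epsilon> > 0"
  shows "\<exists>A\<in>G. measure M (sym_diff S A) < \<epsilon> \<and> measure N (sym_diff S A) < \<epsilon>"
proof -
  interpret M: finite_measure M by fact
  interpret N: finite_measure N by fact
  interpret G: algebra \<Omega> G by fact
  note [simp] = \<open>sets N = sets M\<close>
  have GM: "A \<in> sets M" if "A \<in> G" for A using that G(2) by auto
  have "S \<in> sigma_sets \<Omega> G" using S G(2) by simp
  then show ?thesis using \<open>\<epsilon> > 0\<close>
  proof (induction arbitrary: \<epsilon> rule: sigma_sets.induct)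
    case (Basic a)
    then show ?case by (intro bexI[of _ a]) auto
  next
    case Empty
    then show ?case by (intro bexI[of _ "{}"]) auto
  next
    case (Compl a)
    then obtain A where A: "A \<in> G" "measure M (sym_diff a A) < \<epsilon>" "measure N (sym_diff a A) < \<epsilon>"
      by blast
    have "a \<subseteq> \<Omega>" using Compl.hyps G.space_closed sigma_sets_into_sp by metis
    then have "sym_diff (\<Omega> - a) (\<Omega> - A) = sym_diff a A"
      using A(1) G.sets_into_space by blast
    then show ?case using A by (intro bexI[of _ "\<Omega> - A"]) auto
  next
    case (Union a)
    have a: "a i \<in> sets M" for i using Union.hyps G(2) by simp
    define U where "U n = (\<Union>i<n. a i)" for n
    have U: "U n \<in> sets M" for n using a by (auto simp: U_def)
    have inc: "incseq U" unfolding U_def incseq_def by (force intro: UN_mono)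
    have UU: "(\<Union>n. U n) = (\<Union>i. a i)" by (auto simp: U_def)
    have "(\<lambda>n. measure M (U n)) \<longlonglongrightarrow> measure M (\<Union>i. a i)"
      using M.finite_Lim_measure_incseq[OF _ inc] U UU by auto
    moreover have "(\<lambda>n. measure N (U n)) \<longlonglongrightarrow> measure N (\<Union>i. a i)"
      using N.finite_Lim_measure_incseq[OF _ inc] U UU by auto
    \<comment> \<open>Half of \<epsilon> pays for cutting the union off at \<open>n\<close>. Both
      measures must accept the same \<open>n\<close>, which "eventually" provides.\<close>
    ultimately have "\<forall>\<^sub>F n in sequentially. measure M (U n) > measure M (\<Union>i. a i) - \<epsilon> / 2
        \<and> measure N (U n) > measure N (\<Union>i. a i) - \<epsilon> / 2"
      using Union.prems by (intro eventually_conj order_tendstoD(1)) auto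
    then obtain n where n: "measure M (U n) > measure M (\<Union>i. a i) - \<epsilon> / 2"
        "measure N (U n) > measure N (\<Union>i. a i) - \<epsilon> / 2"
      by (auto simp: eventually_sequentially)
    \<comment> \<open>The other half is shared among the \<open>n\<close> sets that remain;
      \<open>n + 1\<close> keeps the denominator positive when \<open>n = 0\<close>.\<close>
    define \<eta> where "\<eta> = \<epsilon> / (2 * (real n + 1))"
    have "\<eta> > 0" using Union.prems by (simp add: \<eta>_def)
    then have "\<forall>i. \<exists>A\<in>G. measure M (sym_diff (a i) A) < \<eta> \<and> measure N (sym_diff (a i) A) < \<eta>"
      using Union.IH by blast
    then obtain A where A: "\<And>i. A i \<in> G" "\<And>i. measure M (sym_diff (a i) (A i)) < \<eta>"
        "\<And>i. measure N (sym_diff (a i) (A i)) < \<eta>"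
      by metis
    define B where "B = (\<Union>i<n. A i)"
    have sub: "sym_diff (\<Union>i. a i) B \<subseteq> ((\<Union>i. a i) - U n) \<union> (\<Union>i<n. sym_diff (a i) (A i))"
      by (auto simp: U_def B_def)
    have AM: "A i \<in> sets M" for i using A(1) GM by blast
    have bound: "measure L (sym_diff (\<Union>i. a i) B) < \<epsilon>"
      if L: "finite_measure L" "sets L = sets M"
        and 1: "measure L (U n) > measure L (\<Union>i. a i) - \<epsilon> / 2"
        and 2: "\<And>i. measure L (sym_diff (a i) (A i)) < \<eta>" for L
    proof -
      interpret L: finite_measure L by fact
      note [simp] = L(2)
      have "measure L (sym_diff (\<Union>i. a i) B) \<le>
          measure L (((\<Union>i. a i) - U n) \<union> (\<Union>i<n. sym_diff (a i) (A i)))"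
        using a U AM by (intro L.finite_measure_mono sub) auto
      also have "\<dots> \<le> measure L ((\<Union>i. a i) - U n) + measure L (\<Union>i<n. sym_diff (a i) (A i))"
        using a U AM by (intro measure_Un_le) auto
      also have "measure L ((\<Union>i. a i) - U n) = measure L (\<Union>i. a i) - measure L (U n)"
        using a U UU by (intro L.finite_measure_Diff) auto
      also have "\<dots> < \<epsilon> / 2" using 1 by simp
      also have "measure L (\<Union>i<n. sym_diff (a i) (A i)) \<le> (\<Sum>i<n. measure L (sym_diff (a i) (A i)))"
        using a AM by (intro L.finite_measure_subadditive_finite) auto
      also have "\<dots> \<le> (\<Sum>i<n. \<eta>)" using 2 by (intro sum_mono less_imp_le)
      also have "\<dots> \<le> \<epsilon> / 2" using Union.prems by (simp add: \<eta>_def field_simps)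
      finally show ?thesis by simp
    qed
    have "B \<in> G" using A by (auto simp: B_def)
    then show ?case
      using bound[OF M.finite_measure_axioms _ n(1) A(2)] bound[OF N.finite_measure_axioms _ n(2) A(3)]
      by auto
  qed
qed

text \<open>Cylinders over finite sets of coordinates form an algebra that generates the product
  sigma-algebra, so the preceding approximation applies to them.\<close>

lemma PiM_approx_by_cylinder:
  assumes "finite_measure \<mu>" "finite_measure \<nu>"
    and sets: "sets \<mu> = sets (PiM I M)" "sets \<nu> = sets (PiM I M)"
    and M: "\<And>i. i \<in> I \<Longrightarrow> prob_space (M i)"
    and S: "S \<in> sets (PiM I M)" and "\<epsilon> > 0"
  obtains J B where "finite J" "J \<subseteq> I" "B \<in> sets (PiM J M)"
    "measure \<mu> (sym_diff S (prod_emb I M J B)) < \<epsilon>" "measure \<nu> (sym_diff S (prod_emb I M J B)) < \<epsilon>"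
proof -
  \<comment> \<open>The locale \<open>product_prob_space\<close> asks for a probability measure at
    every index, whereas \<open>M\<close> is controlled only on \<open>I\<close>. Outside
    \<open>I\<close> it is replaced by a one-point space, which changes neither the products over
    subsets of \<open>I\<close> nor the cylinders.\<close>
  define M' where "M' i = (if i \<in> I then M i else count_space {undefined})" for i
  interpret M': prob_space "M' i" for i
    using M by (cases "i \<in> I") (auto intro!: prob_spaceI simp: M'_def)
  interpret product_prob_space M' I by unfold_locales
  have eq: "PiM J M' = PiM J M" if "J \<subseteq> I" for J
    using that by (intro PiM_cong) (auto simp: M'_def)
  have emb: "prod_emb I M' J B = prod_emb I M J B" for J B
    by (auto simp: prod_emb_def PiE_iff M'_def)
  obtain A where A: "A \<in> generator" "measure \<mu> (sym_diff S A) < \<epsilon>" "measure \<nu> (sym_diff S A) < \<epsilon>"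
    using measure_approx_by_algebra[OF assms(1,2) _ algebra_generator _ _ \<open>\<epsilon> > 0\<close>, of S]
      sets S sets_PiM_generator eq[of I] by auto
  from A(1) show thesis
    using that A(2,3) by (cases rule: generator.cases) (auto simp: eq emb)
qed

section \<open>Total variation distance of product measures\<close>

lemma tv_dist_ge:
  assumes "prob_space \<mu>" "prob_space \<nu>" "A \<in> sets \<mu>"
  shows "\<bar>measure \<mu> A - measure \<nu> A\<bar> \<le> tv_dist \<mu> \<nu>"
  unfolding tv_dist_def
proof (rule cSUP_upper)
  show "bdd_above ((\<lambda>A. \<bar>measure \<mu> A - measure \<nu> A\<bar>) ` sets \<mu>)"
    using prob_space.prob_le_1[OF assms(1)] prob_space.prob_le_1[OF assms(2)]
    by (intro bdd_aboveI2[of _ _ 2]) (smt (verit) measure_nonneg)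
qed fact

lemma tv_dist_nonneg:
  assumes "prob_space \<mu>" "prob_space \<nu>"
  shows "0 \<le> tv_dist \<mu> \<nu>"
  using tv_dist_ge[OF assms sets.empty_sets] by simp

lemma emeasure_le_tv_dist:
  assumes "prob_space \<mu>" "prob_space \<nu>" "A \<in> sets \<mu>"
  shows "emeasure \<mu> A \<le> emeasure \<nu> A + ennreal (tv_dist \<mu> \<nu>)"
proof -
  interpret \<mu>: prob_space \<mu> by fact
  interpret \<nu>: prob_space \<nu> by fact
  have "measure \<mu> A \<le> measure \<nu> A + tv_dist \<mu> \<nu>"
    using tv_dist_ge[OF assms] by simp
  then show ?thesis
    using tv_dist_nonneg[OF assms(1,2)]
    by (simp add: \<mu>.emeasure_eq_measure \<nu>.emeasure_eq_measure flip: ennreal_plus)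
qed

text \<open>The factors are exchanged one at a time, passing through
  \<open>P \<Otimes>\<^sub>M Q'\<close>. Each exchange applies the one-factor bound to the sections
  of \<open>S\<close> and integrates it against a probability measure, so the additive error keeps
  its size.\<close>

lemma emeasure_pair_le_add:
  assumes "prob_space P" "prob_space P'" "prob_space Q" "prob_space Q'"
    and sets: "sets P = sets P'" "sets Q = sets Q'"
    and P: "\<And>A. A \<in> sets P \<Longrightarrow> emeasure P A \<le> emeasure P' A + c"
    and Q: "\<And>A. A \<in> sets Q \<Longrightarrow> emeasure Q A \<le> emeasure Q' A + d"
    and S: "S \<in> sets (P \<Otimes>\<^sub>M Q)"
  shows "emeasure (P \<Otimes>\<^sub>M Q) S \<le> emeasure (P' \<Otimes>\<^sub>M Q') S + (c + d)"
proof -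
  interpret P: prob_space P by fact
  interpret P': prob_space P' by fact
  interpret Q: prob_space Q by fact
  interpret Q': prob_space Q' by fact
  interpret PQ': pair_prob_space P Q' ..
  interpret PQ'': pair_prob_space P' Q' ..
  have S1: "S \<in> sets (P \<Otimes>\<^sub>M Q')" and S2: "S \<in> sets (P' \<Otimes>\<^sub>M Q')"
    using S sets sets_pair_measure_cong by metis+
  have "emeasure (P \<Otimes>\<^sub>M Q) S = (\<integral>\<^sup>+x. emeasure Q (Pair x -` S) \<partial>P)"
    by (rule Q.emeasure_pair_measure_alt[OF S])
  also have "\<dots> \<le> (\<integral>\<^sup>+x. emeasure Q' (Pair x -` S) + d \<partial>P)"
    by (intro nn_integral_mono Q sets_Pair1[OF S])
  also have "\<dots> = emeasure (P \<Otimes>\<^sub>M Q') S + d"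
    using Q'.measurable_emeasure_Pair[OF S1]
    by (simp add: nn_integral_add P.emeasure_space_1 Q'.emeasure_pair_measure_alt[OF S1])
  also have "emeasure (P \<Otimes>\<^sub>M Q') S = (\<integral>\<^sup>+y. emeasure P ((\<lambda>x. (x, y)) -` S) \<partial>Q')"
    by (rule PQ'.emeasure_pair_measure_alt2[OF S1])
  also have "\<dots> \<le> (\<integral>\<^sup>+y. emeasure P' ((\<lambda>x. (x, y)) -` S) + c \<partial>Q')"
    by (intro nn_integral_mono P sets_Pair2[OF S1])
  also have "\<dots> = emeasure (P' \<Otimes>\<^sub>M Q') S + c"
    using PQ''.measurable_emeasure_Pair2[OF S2]
    by (simp add: nn_integral_add Q'.emeasure_space_1 PQ''.emeasure_pair_measure_alt2[OF S2])
  finally show ?thesis by (simp add: ac_simps)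
qed

text \<open>Induction on \<open>J\<close>: the product over \<open>insert i J\<close> is the image
  of a binary product, where the errors of the two factors add up.\<close>

lemma emeasure_PiM_finite_le_tv_dist:
  assumes "finite J"
    and "\<And>i. i \<in> J \<Longrightarrow> prob_space (p i)" "\<And>i. i \<in> J \<Longrightarrow> prob_space (q i)"
    and "\<And>i. i \<in> J \<Longrightarrow> sets (p i) = sets (q i)"
    and "S \<in> sets (PiM J p)"
  shows "emeasure (PiM J p) S \<le> emeasure (PiM J q) S + ennreal (\<Sum>i\<in>J. tv_dist (p i) (q i))"
  using assms
proof (induction arbitrary: S rule: finite_induct)
  case empty
  then show ?case by (simp add: PiM_empty)
next
  case (insert i J)
  have prob: "prob_space (p i)" "prob_space (q i)" "prob_space (PiM J p)" "prob_space (PiM J q)"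
    using insert.prems by (auto intro!: prob_space_PiM)
  have nonneg: "0 \<le> tv_dist (p j) (q j)" if "j \<in> insert i J" for j
    using that insert.prems by (intro tv_dist_nonneg) auto
  have sets: "sets (p i) = sets (q i)" "sets (PiM J p) = sets (PiM J q)"
    "sets (PiM (insert i J) p) = sets (PiM (insert i J) q)"
    using insert.prems by (auto intro!: sets_PiM_cong)
  \<comment> \<open>With equal underlying spaces, the preimage \<open>?S\<close> of \<open>S\<close>
    is the same set for \<open>p\<close> and for \<open>q\<close>.\<close>
  have space: "space (p i \<Otimes>\<^sub>M PiM J p) = space (q i \<Otimes>\<^sub>M PiM J q)"
    using sets by (intro sets_eq_imp_space_eq sets_pair_measure_cong)
  define f where "f = (\<lambda>(x::'b, X). X(i := x))"
  have f: "f \<in> measurable (r i \<Otimes>\<^sub>M PiM J r) (PiM (insert i J) r)" for r :: "'a \<Rightarrow> 'b measure"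
    unfolding f_def by measurable
  let ?S = "f -` S \<inter> space (p i \<Otimes>\<^sub>M PiM J p)"
  have S: "S \<in> sets (PiM (insert i J) p)" "S \<in> sets (PiM (insert i J) q)"
    using insert.prems sets by auto
  have emeasure_insert: "emeasure (PiM (insert i J) r) S =
      emeasure (r i \<Otimes>\<^sub>M PiM J r) (f -` S \<inter> space (r i \<Otimes>\<^sub>M PiM J r))"
    if "\<And>j. j \<in> insert i J \<Longrightarrow> prob_space (r j)" "S \<in> sets (PiM (insert i J) r)" for r
    using distr_pair_PiM_eq_PiM[of J r i] emeasure_distr[OF f that(2)] that(1) by (simp add: f_def)
  have "emeasure (PiM (insert i J) p) S = emeasure (p i \<Otimes>\<^sub>M PiM J p) ?S"
    using insert.prems S by (intro emeasure_insert) auto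
  also have "\<dots> \<le> emeasure (q i \<Otimes>\<^sub>M PiM J q) ?S +
      (ennreal (tv_dist (p i) (q i)) + ennreal (\<Sum>i\<in>J. tv_dist (p i) (q i)))"
    using insert.prems
    by (intro emeasure_pair_le_add prob sets emeasure_le_tv_dist insert.IH measurable_sets[OF f S(1)]) auto
  also have "emeasure (q i \<Otimes>\<^sub>M PiM J q) ?S = emeasure (PiM (insert i J) q) S"
    unfolding space using insert.prems S by (intro emeasure_insert[symmetric]) auto
  finally show ?case
    using insert.hyps nonneg by (simp add: sum_nonneg ennreal_plus)
qed

text \<open>Consistency of the finite marginals of a product, for a family that is controlled only
  on \<open>I\<close>. The values outside \<open>I\<close> are again replaced by one-point
  spaces.\<close>

lemma emeasure_PiM_prod_emb:
  assumes "\<And>i. i \<in> I \<Longrightarrow> prob_space (M i)" "J \<subseteq> I" "finite J" "B \<in> sets (PiM J M)"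
  shows "emeasure (PiM I M) (prod_emb I M J B) = emeasure (PiM J M) B"
proof -
  define M' where "M' i = (if i \<in> I then M i else count_space {undefined})" for i
  interpret M': prob_space "M' i" for i
    using assms(1) by (cases "i \<in> I") (auto intro!: prob_spaceI simp: M'_def)
  interpret product_prob_space M' I by unfold_locales
  have eq: "PiM J M' = PiM J M" if "J \<subseteq> I" for J
    using that by (intro PiM_cong) (auto simp: M'_def)
  have "prod_emb I M' J B = prod_emb I M J B"
    by (auto simp: prod_emb_def PiE_iff M'_def)
  then show ?thesis
    using emeasure_PiM_emb'[of J B] assms eq[of I] eq[of J] by simp
qed

text \<open>For a cylinder only finitely many factors matter, and the finite bound applies with a
  partial sum of the series. A general \<open>S\<close> is replaced by a cylinder close to it under
  both products, at a cost of \<epsilon> / 2 on each side.\<close>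

lemma measure_PiM_le_tv_dist:
  assumes p: "\<And>i. i \<in> I \<Longrightarrow> prob_space (p i)" and q: "\<And>i. i \<in> I \<Longrightarrow> prob_space (q i)"
    and sets: "\<And>i. i \<in> I \<Longrightarrow> sets (p i) = sets (q i)"
    and summable: "(\<lambda>i. tv_dist (p i) (q i)) summable_on I"
    and S: "S \<in> sets (PiM I p)"
  shows "measure (PiM I p) S \<le> measure (PiM I q) S + (\<Sum>\<^sub>\<infinity>i\<in>I. tv_dist (p i) (q i))"
proof (rule field_le_epsilon)
  fix \<epsilon> :: real assume "\<epsilon> > 0"
  interpret p: prob_space "PiM I p" using p by (rule prob_space_PiM)
  interpret q: prob_space "PiM I q" using q by (rule prob_space_PiM)
  have sets_PiM: "sets (PiM J p) = sets (PiM J q)" if "J \<subseteq> I" for J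
    using sets that by (intro sets_PiM_cong) auto
  have nonneg: "0 \<le> tv_dist (p i) (q i)" if "i \<in> I" for i
    using p[OF that] q[OF that] by (rule tv_dist_nonneg)
  obtain J B where J: "finite J" "J \<subseteq> I" and B: "B \<in> sets (PiM J p)"
    and approx: "measure (PiM I p) (sym_diff S (prod_emb I p J B)) < \<epsilon> / 2"
      "measure (PiM I q) (sym_diff S (prod_emb I p J B)) < \<epsilon> / 2"
    using PiM_approx_by_cylinder[OF p.finite_measure_axioms q.finite_measure_axioms refl
        sets_PiM[symmetric, OF subset_refl] p S, of "\<epsilon> / 2"] \<open>\<epsilon> > 0\<close> by (metis half_gt_zero)
  define A where "A = prod_emb I p J B"
  have A: "A \<in> sets (PiM I p)" using J B unfolding A_def by (intro measurable_prod_emb) auto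
  \<comment> \<open>An embedding sees only the underlying spaces of the factors, so \<open>A\<close>
    is a cylinder with base \<open>B\<close> for \<open>q\<close> as well.\<close>
  have A_q: "A = prod_emb I q J B"
    using sets_eq_imp_space_eq[OF sets] by (auto simp: A_def prod_emb_def PiE_iff)
  note [simp] = sets_PiM[symmetric, OF subset_refl]
  interpret pJ: prob_space "PiM J p" using p J by (intro prob_space_PiM) auto
  interpret qJ: prob_space "PiM J q" using q J by (intro prob_space_PiM) auto
  have "measure (PiM I p) S \<le> measure (PiM I p) (A \<union> sym_diff S A)"
    using S A by (intro p.finite_measure_mono) auto
  also have "\<dots> \<le> measure (PiM I p) A + measure (PiM I p) (sym_diff S A)"
    using S A by (intro measure_Un_le) auto
  also have "measure (PiM I p) A = measure (PiM J p) B"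
    using emeasure_PiM_prod_emb[OF p J(2,1) B] by (simp add: A_def measure_def)
  also have "\<dots> \<le> measure (PiM J q) B + (\<Sum>i\<in>J. tv_dist (p i) (q i))"
  proof -
    have "emeasure (PiM J p) B \<le> emeasure (PiM J q) B + ennreal (\<Sum>i\<in>J. tv_dist (p i) (q i))"
      using J p q sets B by (intro emeasure_PiM_finite_le_tv_dist) auto
    moreover have "0 \<le> (\<Sum>i\<in>J. tv_dist (p i) (q i))"
      using J nonneg by (intro sum_nonneg) auto
    ultimately show ?thesis
      by (simp add: pJ.emeasure_eq_measure qJ.emeasure_eq_measure flip: ennreal_plus)
  qed
  also have "measure (PiM J q) B = measure (PiM I q) A"
    using emeasure_PiM_prod_emb[OF q J(2,1)] B sets_PiM[OF J(2)] by (simp add: A_q measure_def)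
  also have "measure (PiM I q) A \<le> measure (PiM I q) (S \<union> sym_diff S A)"
    using S A by (intro q.finite_measure_mono) auto
  also have "\<dots> \<le> measure (PiM I q) S + measure (PiM I q) (sym_diff S A)"
    using S A by (intro measure_Un_le) auto
  \<comment> \<open>Nonnegativity of the distances makes the infinite sum dominate every finite
    partial sum, whatever \<open>J\<close> the approximation produced.\<close>
  also have "(\<Sum>i\<in>J. tv_dist (p i) (q i)) \<le> (\<Sum>\<^sub>\<infinity>i\<in>I. tv_dist (p i) (q i))"
    using J nonneg summable by (intro finite_sum_le_infsum) auto
  finally show "measure (PiM I p) S \<le> measure (PiM I q) S + (\<Sum>\<^sub>\<infinity>i\<in>I. tv_dist (p i) (q i)) + \<epsilon>"
    using approx by (simp add: A_def)
qed

section \<open>The zero-one law on the product space\<close>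

text \<open>The joint law of the coordinates is the product measure itself, since restricting a
  point of the product to \<open>I\<close> does nothing; this is the product of the laws of the
  coordinates.\<close>

lemma indep_vars_PiM_coordinate:
  assumes M: "\<And>i. i \<in> I \<Longrightarrow> prob_space (M i)" and "I \<noteq> {}"
  shows "prob_space.indep_vars (PiM I M) M (\<lambda>i \<omega>. \<omega> i) I"
proof -
  interpret prob_space "PiM I M" using M by (rule prob_space_PiM)
  have "distr (PiM I M) (PiM I M) (\<lambda>\<omega>. \<lambda>i\<in>I. \<omega> i) = distr (PiM I M) (PiM I M) (\<lambda>\<omega>. \<omega>)"
    by (intro distr_cong) (auto simp: space_PiM PiE_restrict)
  also have "\<dots> = PiM I (\<lambda>i. distr (PiM I M) (M i) (\<lambda>\<omega>. \<omega> i))"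
    using M by (auto simp: distr_PiM_component intro!: PiM_cong)
  finally show ?thesis
    using \<open>I \<noteq> {}\<close> by (subst indep_vars_iff_distr_eq_PiM') auto
qed

lemma positional_symmetry_zero_one:
  fixes \<Gamma> :: "'i set" and p :: "'i \<Rightarrow> 'a measure"
  assumes "\<Gamma> \<noteq> {}"
    and p: "\<And>k. k \<in> \<Gamma> \<Longrightarrow> prob_space (p k)" "\<And>k. k \<in> \<Gamma> \<Longrightarrow> sets (p k) = sets M"
    and E: "E \<in> sets (PiM \<Gamma> (\<lambda>_. M))"
    and sym: "\<And>J (\<delta>::real). finite J \<Longrightarrow> J \<subseteq> \<Gamma> \<Longrightarrow> \<delta> > 0 \<Longrightarrow>
           \<exists>\<pi>. positional_symmetry \<Gamma> M E \<pi> \<and> inj_on \<pi> \<Gamma> \<and> \<pi> ` J \<inter> J = {} \<and>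
             (\<lambda>k. tv_dist (p (\<pi> k)) (p k)) summable_on \<Gamma> \<and>
             (\<Sum>\<^sub>\<infinity>k\<in>\<Gamma>. tv_dist (p (\<pi> k)) (p k)) < \<delta>"
  shows "measure (PiM \<Gamma> p) E \<in> {0, 1}"
proof -
  interpret \<mu>: prob_space "PiM \<Gamma> p" using p(1) by (rule prob_space_PiM)
  have sets_PiM: "sets (PiM J p) = sets (PiM J (\<lambda>_. M))" if "J \<subseteq> \<Gamma>" for J
    using p(2) that by (intro sets_PiM_cong) auto
  have space_eq: "space (PiM \<Gamma> p) = space (PiM \<Gamma> (\<lambda>_. M))"
    by (intro sets_eq_imp_space_eq sets_PiM) simp
  have E': "E \<in> sets (PiM \<Gamma> p)" using E sets_PiM by simp
  \<comment> \<open>The events \<open>A\<close> and \<open>A'\<close> below miss \<open>E\<close> by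
    at most \<epsilon> and 2 * \<epsilon>. These errors enter twice: once in comparing
    \<open>E\<close> with the intersection of \<open>A\<close> and \<open>A'\<close>, once in
    replacing the two factors of the square.\<close>
  have quasi_indep: "\<bar>\<mu>.prob E - \<mu>.prob E * \<mu>.prob E\<bar> \<le> 6 * \<epsilon>" if "\<epsilon> > 0" for \<epsilon> :: real
  proof -
    obtain J B where J: "finite J" "J \<subseteq> \<Gamma>" and B: "B \<in> sets (PiM J p)"
      and approx: "measure (PiM \<Gamma> p) (sym_diff E (prod_emb \<Gamma> p J B)) < \<epsilon>"
      using PiM_approx_by_cylinder[OF \<mu>.finite_measure_axioms \<mu>.finite_measure_axioms refl refl p(1) E' \<open>\<epsilon> > 0\<close>]
      by metis
    define A where "A = prod_emb \<Gamma> p J B"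
    have A: "A \<in> sets (PiM \<Gamma> p)" using J B unfolding A_def by (intro measurable_prod_emb) auto
    obtain \<pi> where \<pi>: "positional_symmetry \<Gamma> M E \<pi>" and inj: "inj_on \<pi> \<Gamma>" and disj: "\<pi> ` J \<inter> J = {}"
      and summable: "(\<lambda>k. tv_dist (p (\<pi> k)) (p k)) summable_on \<Gamma>"
      and small: "(\<Sum>\<^sub>\<infinity>k\<in>\<Gamma>. tv_dist (p (\<pi> k)) (p k)) < \<epsilon>"
      using sym[OF J \<open>\<epsilon> > 0\<close>] by blast
    have \<pi>\<Gamma>: "\<pi> \<in> \<Gamma> \<rightarrow> \<Gamma>" using \<pi> by (simp add: positional_symmetry_def)
    define T where "T a = (\<lambda>k\<in>\<Gamma>. a (\<pi> k))" for a :: "'i \<Rightarrow> 'a"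
    let ?\<mu>' = "PiM \<Gamma> (\<lambda>k. p (\<pi> k))"
    have sets': "sets ?\<mu>' = sets (PiM \<Gamma> p)"
      using p(2) \<pi>\<Gamma> by (intro sets_PiM_cong) auto
    have T': "T \<in> measurable (PiM \<Gamma> p) ?\<mu>'"
      unfolding T_def using \<pi>\<Gamma> by (intro measurable_restrict measurable_component_singleton) auto
    then have T: "T \<in> measurable (PiM \<Gamma> p) (PiM \<Gamma> p)"
      using sets' measurable_cong_sets by blast
    \<comment> \<open>Injectivity of \<pi> enters here: distinct indices read distinct, hence
      independent, coordinates, so the image measure is again a product.\<close>
    have distr_T: "distr (PiM \<Gamma> p) ?\<mu>' T = ?\<mu>'"
      unfolding T_def using p(1) inj \<pi>\<Gamma> by (intro distr_PiM_reindex) auto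
    define A' where "A' = T -` A \<inter> space (PiM \<Gamma> p)"
    have A': "A' \<in> sets (PiM \<Gamma> p)" unfolding A'_def using T A by (rule measurable_sets)
    have TE: "a \<in> E \<longleftrightarrow> T a \<in> E" if "a \<in> space (PiM \<Gamma> p)" for a
      using \<pi> that unfolding positional_symmetry_def T_def space_eq by blast
    have approx': "\<mu>.prob (sym_diff E A') \<le> 2 * \<epsilon>"
    proof -
      \<comment> \<open>As \<pi> is a symmetry, \<open>E\<close> is its own preimage under
        \<open>T\<close>, so the whole symmetric difference is a preimage. Its probability can be
        computed under the image measure, which the small sum of distances keeps close to the
        original one.\<close>
      have "sym_diff E A' = T -` sym_diff E A \<inter> space (PiM \<Gamma> p)"
        using TE sets.sets_into_space[OF E'] by (auto simp: A'_def)
      then have "\<mu>.prob (sym_diff E A') = measure (distr (PiM \<Gamma> p) ?\<mu>' T) (sym_diff E A)"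
        using E' A sets' T' by (subst measure_distr) auto
      also have "\<dots> = measure ?\<mu>' (sym_diff E A)" by (simp add: distr_T)
      also have "\<dots> \<le> \<mu>.prob (sym_diff E A) + (\<Sum>\<^sub>\<infinity>k\<in>\<Gamma>. tv_dist (p (\<pi> k)) (p k))"
        using p \<pi>\<Gamma> summable E' A sets' by (intro measure_PiM_le_tv_dist) (auto simp: Pi_iff)
      finally show ?thesis using approx small by (simp add: A_def)
    qed
    have indep: "\<mu>.prob (A \<inter> A') = \<mu>.prob A * \<mu>.prob A'"
    proof -
      \<comment> \<open>This map reads a point indexed by the image of \<open>J\<close> under \<pi>
        as a point indexed by \<open>J\<close>; it exhibits \<open>A'\<close> as a cylinder over
        that image.\<close>
      define g where "g y = (\<lambda>k\<in>J. y (\<pi> k))" for y :: "'i \<Rightarrow> 'a"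
      \<comment> \<open>Measurability of \<open>g\<close> is natural for the reindexed factors,
        while \<open>B\<close> lives over the original ones; all factors share the sigma-algebra of
        \<open>M\<close>.\<close>
      have "sets (PiM J (\<lambda>k. p (\<pi> k))) = sets (PiM J p)"
        using p(2) \<pi>\<Gamma> J by (intro sets_PiM_cong) (auto simp: Pi_iff subset_iff)
      then have C: "g -` B \<inter> space (PiM (\<pi> ` J) p) \<in> sets (PiM (\<pi> ` J) p)"
        using B unfolding g_def
        by (intro measurable_sets[where A = "PiM J (\<lambda>k. p (\<pi> k))"] measurable_restrict
            measurable_component_singleton) auto
      \<comment> \<open>Disjointness of \<open>J\<close> from its image under \<pi> gives
        independence of the two blocks of coordinates.\<close>
      have "\<mu>.indep_var (PiM J p) (\<lambda>\<omega>. restrict (\<lambda>i. \<omega> i) J)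
          (PiM (\<pi> ` J) p) (\<lambda>\<omega>. restrict (\<lambda>i. \<omega> i) (\<pi> ` J))"
        using indep_vars_PiM_coordinate[OF p(1) \<open>\<Gamma> \<noteq> {}\<close>] J \<pi>\<Gamma> disj
        by (intro \<mu>.indep_var_restrict) auto
      from \<mu>.indep_varD[OF this B C]
      have "\<mu>.prob ((\<lambda>\<omega>. (restrict \<omega> J, restrict \<omega> (\<pi> ` J))) -`
            (B \<times> (g -` B \<inter> space (PiM (\<pi> ` J) p))) \<inter> space (PiM \<Gamma> p)) =
          \<mu>.prob ((\<lambda>\<omega>. restrict \<omega> J) -` B \<inter> space (PiM \<Gamma> p)) *
          \<mu>.prob ((\<lambda>\<omega>. restrict \<omega> (\<pi> ` J)) -` (g -` B \<inter> space (PiM (\<pi> ` J) p)) \<inter> space (PiM \<Gamma> p))"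
        by simp
      moreover have A_eq: "A = (\<lambda>\<omega>. restrict \<omega> J) -` B \<inter> space (PiM \<Gamma> p)"
        by (auto simp: A_def prod_emb_def space_PiM)
      moreover have A'_eq: "A' = (\<lambda>\<omega>. restrict \<omega> (\<pi> ` J)) -` (g -` B \<inter> space (PiM (\<pi> ` J) p)) \<inter> space (PiM \<Gamma> p)"
      proof -
        have "T \<omega> \<in> A \<longleftrightarrow> restrict \<omega> (\<pi> ` J) \<in> g -` B \<inter> space (PiM (\<pi> ` J) p)"
          if \<omega>: "\<omega> \<in> space (PiM \<Gamma> p)" for \<omega>
        proof -
          have "restrict (T \<omega>) J = g (restrict \<omega> (\<pi> ` J))"
            using J by (auto simp: T_def g_def fun_eq_iff restrict_def)
          moreover have "T \<omega> \<in> space (PiM \<Gamma> p)"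
            using T \<omega> by (rule measurable_space)
          moreover have "restrict \<omega> (\<pi> ` J) \<in> space (PiM (\<pi> ` J) p)"
            using \<omega> J \<pi>\<Gamma> by (auto simp: space_PiM PiE_iff Pi_iff)
          ultimately show ?thesis by (simp add: A_eq)
        qed
        then show ?thesis by (auto simp: A'_def)
      qed
      moreover have "A \<inter> A' = (\<lambda>\<omega>. (restrict \<omega> J, restrict \<omega> (\<pi> ` J))) -`
          (B \<times> (g -` B \<inter> space (PiM (\<pi> ` J) p))) \<inter> space (PiM \<Gamma> p)"
        unfolding A_eq A'_eq by auto
      ultimately show ?thesis by simp
    qed
    have close: "\<bar>\<mu>.prob E - \<mu>.prob S\<bar> \<le> \<mu>.prob (sym_diff E S)" if S: "S \<in> sets (PiM \<Gamma> p)" for S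
    proof -
      have "\<mu>.prob E \<le> \<mu>.prob (S \<union> sym_diff E S)" "\<mu>.prob S \<le> \<mu>.prob (E \<union> sym_diff E S)"
        using S E' by (auto intro!: \<mu>.finite_measure_mono)
      moreover have "\<mu>.prob (S \<union> sym_diff E S) \<le> \<mu>.prob S + \<mu>.prob (sym_diff E S)"
        "\<mu>.prob (E \<union> sym_diff E S) \<le> \<mu>.prob E + \<mu>.prob (sym_diff E S)"
        using S E' by (auto intro!: measure_Un_le)
      ultimately show ?thesis by linarith
    qed
    have "\<mu>.prob (sym_diff E (A \<inter> A')) \<le> \<mu>.prob (sym_diff E A \<union> sym_diff E A')"
      using E' A A' by (intro \<mu>.finite_measure_mono) auto
    also have "\<dots> \<le> \<mu>.prob (sym_diff E A) + \<mu>.prob (sym_diff E A')"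
      using E' A A' by (intro measure_Un_le) auto
    also have "\<dots> \<le> 3 * \<epsilon>" using approx approx' by (simp add: A_def)
    finally have 3: "\<bar>\<mu>.prob E - \<mu>.prob A * \<mu>.prob A'\<bar> \<le> 3 * \<epsilon>"
      using close[of "A \<inter> A'"] A A' indep by simp
    \<comment> \<open>The factors are replaced one at a time; the remaining factor is a probability
      and hence at most 1.\<close>
    have "\<bar>\<mu>.prob E * \<mu>.prob E - \<mu>.prob A * \<mu>.prob A'\<bar> =
        \<bar>\<mu>.prob E * (\<mu>.prob E - \<mu>.prob A) + \<mu>.prob A * (\<mu>.prob E - \<mu>.prob A')\<bar>"
      by (simp add: algebra_simps)
    also have "\<dots> \<le> \<mu>.prob E * \<bar>\<mu>.prob E - \<mu>.prob A\<bar> + \<mu>.prob A * \<bar>\<mu>.prob E - \<mu>.prob A'\<bar>"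
      by (rule order.trans[OF abs_triangle_ineq]) (simp add: abs_mult)
    also have "\<dots> \<le> 1 * \<epsilon> + 1 * (2 * \<epsilon>)"
      using close[OF A] close[OF A'] approx approx' \<open>\<epsilon> > 0\<close>
      by (intro add_mono mult_mono) (auto simp: A_def)
    finally show ?thesis using 3 by linarith
  qed
  \<comment> \<open>Letting \<epsilon> tend to 0 makes the probability of \<open>E\<close> a root of
    x * (1 - x).\<close>
  have "\<bar>\<mu>.prob E - \<mu>.prob E * \<mu>.prob E\<bar> \<le> 0"
  proof (rule field_le_epsilon)
    fix e :: real assume "e > 0"
    then show "\<bar>\<mu>.prob E - \<mu>.prob E * \<mu>.prob E\<bar> \<le> 0 + e" using quasi_indep[of "e / 6"] by simp
  qed
  then have "\<mu>.prob E * (1 - \<mu>.prob E) = 0" by (simp add: algebra_simps)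
  then show ?thesis by auto
qed

section \<open>Transfer to a family of independent random variables\<close>

theorem theorem2:
  fixes \<Gamma> :: "'i set"
    and M :: "'a measure"
    and P :: "'w measure"
    and X :: "'i \<Rightarrow> 'w \<Rightarrow> 'a"
    and p :: "'i \<Rightarrow> 'a measure"
    and E :: "('i \<Rightarrow> 'a) set"
  assumes "countable \<Gamma>"
    and "prob_space P"
    and "\<And>k. k \<in> \<Gamma> \<Longrightarrow> prob_space (p k)"
    and "\<And>k. k \<in> \<Gamma> \<Longrightarrow> sets (p k) = sets M"
    and "prob_space.indep_vars P (\<lambda>_. M) X \<Gamma>"
    and "\<And>k. k \<in> \<Gamma> \<Longrightarrow> distr P M (X k) = p k"
    and "E \<in> sets (PiM \<Gamma> (\<lambda>_. M))"
    and "\<And>J (\<delta>::real). finite J \<Longrightarrow> J \<subseteq> \<Gamma> \<Longrightarrow> \<delta> > 0 \<Longrightarrow>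
           \<exists>\<pi>. positional_symmetry \<Gamma> M E \<pi> \<and> inj_on \<pi> \<Gamma> \<and> \<pi> ` J \<inter> J = {} \<and>
             (\<lambda>k. tv_dist (p (\<pi> k)) (p k)) summable_on \<Gamma> \<and>
             (\<Sum>\<^sub>\<infinity>k\<in>\<Gamma>. tv_dist (p (\<pi> k)) (p k)) < \<delta>"
  shows "measure P {\<omega> \<in> space P. (\<lambda>k\<in>\<Gamma>. X k \<omega>) \<in> E} \<in> {0, 1}"
proof (cases "\<Gamma> = {}")
  \<comment> \<open>Here the family takes the single value that is \<open>undefined\<close>
    everywhere, so the event is empty or the whole space. The case is separate because the
    characterisation of independence by the joint law is applied to a nonempty index set.\<close>
  case True
  interpret P: prob_space P by fact
  show ?thesis using True P.prob_space by (cases "(\<lambda>_. undefined) \<in> E") (auto simp: restrict_def)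
next
  case False
  interpret P: prob_space P by fact
  define Y where "Y \<omega> = (\<lambda>k\<in>\<Gamma>. X k \<omega>)" for \<omega>
  have rv: "X k \<in> measurable P M" if "k \<in> \<Gamma>" for k
    using assms(5) that by (auto simp: P.indep_vars_def)
  \<comment> \<open>Independence says exactly that the joint law is the product of the marginal
    laws, which reduces the claim to the product space.\<close>
  have "distr P (PiM \<Gamma> (\<lambda>_. M)) Y = PiM \<Gamma> (\<lambda>k. distr P M (X k))"
    unfolding Y_def using P.indep_vars_iff_distr_eq_PiM'[OF False rv] assms(5) by simp
  also have "\<dots> = PiM \<Gamma> p" using assms(6) by (intro PiM_cong) auto
  finally have distr_Y: "distr P (PiM \<Gamma> (\<lambda>_. M)) Y = PiM \<Gamma> p" .
  have "Y \<in> measurable P (PiM \<Gamma> (\<lambda>_. M))"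
    unfolding Y_def using rv by (intro measurable_restrict)
  from measure_distr[OF this assms(7)]
  have "measure P {\<omega> \<in> space P. (\<lambda>k\<in>\<Gamma>. X k \<omega>) \<in> E} = measure (PiM \<Gamma> p) E"
    by (simp add: distr_Y Y_def vimage_def Int_def conj_commute)
  then show ?thesis
    using positional_symmetry_zero_one[OF False assms(3,4,7,8)] by simp
qed

end
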